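(* Let $G$ and $H$ be finite, simple, connected, undirected graphs, and suppose that $G$ is a cograph, i.e. $G$ contains no induced subgraph isomorphic to the path $P_4$ on four vertices. Then $$\gamma(G\square H)\geq \gamma(G)\,\gamma(H),$$ where $\gamma$ denotes the domination number and $\square$ denotes the Cartesian product of graphs.
   Context: All graphs are finite, simple, connected and undirected. For a graph $G=(V,E)$, a subset $S\subseteq V$ dominates $G$ if every vertex of $G$ lies in $S$ or is adjacent to a vertex of $S$ (that is, the closed neighborhood $N[S]$ is all of $V$). The domination number $\gamma(G)$ is the minimum cardinality of a dominating set of $G$. A graph is a cograph (equivalently, $P_4$-free) if it contains no induced subgraph isomorphic to $P_4$, the path on four vertices. The Cartesian product $G_1\square G_2$ of graphs $G_1=(V_1,E_1)$ and $G_2=(V_2,E_2)$ is the graph with vertex set $V_1\times V_2$ in which $(u_1,v_1)$ and $(u_2,v_2)$ are adjacent if and only if either $v_1=v_2$ and $u_1u_2\in E_1$, or $u_1=u_2$ and $v_1v_2\in E_2$. *)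

theory Defs
  imports "Graph_Theory.Graph_Theory"
begin

text \<open>
  A finite simple undirected graph is a \<^locale>\<open>pair_graph\<close>: every edge \<open>uv\<close> is represented by
  the two arcs \<open>(u, v)\<close> and \<open>(v, u)\<close>. Where a library notion expects a \<open>pre_digraph\<close>, the
  coercion \<^const>\<open>with_proj\<close> is inserted silently.
\<close>

definition dominating_set :: "'a pair_pre_digraph \<Rightarrow> 'a set \<Rightarrow> bool" where
  "dominating_set G S \<longleftrightarrow>
     S \<subseteq> pverts G \<and> (\<forall>v \<in> pverts G. v \<in> S \<or> (\<exists>u \<in> S. (u, v) \<in> parcs G))"

text \<open>Only meaningful for finite graphs, since \<^const>\<open>card\<close> is 0 on infinite sets.\<close>

definition domination_number :: "'a pair_pre_digraph \<Rightarrow> nat" (\<open>\<gamma>\<close>) where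
  "\<gamma> G = (LEAST k. \<exists>S. dominating_set G S \<and> card S = k)"

definition path_graph :: "nat \<Rightarrow> nat pair_pre_digraph" where
  "path_graph n =
     \<lparr> pverts = {..<n}, parcs = {(i, j). i < n \<and> j < n \<and> (j = Suc i \<or> i = Suc j)} \<rparr>"

definition cograph :: "'a pair_pre_digraph \<Rightarrow> bool" where
  "cograph G \<longleftrightarrow> \<not> (\<exists>H. induced_subgraph H G \<and> digraph_iso H (path_graph 4))"

definition cartesian_product ::
  "'a pair_pre_digraph \<Rightarrow> 'b pair_pre_digraph \<Rightarrow> ('a \<times> 'b) pair_pre_digraph" (infixl \<open>\<box>\<close> 70) where
  "G \<box> H =
     \<lparr> pverts = pverts G \<times> pverts H,
       parcs = {((u\<^sub>1, v\<^sub>1), (u\<^sub>2, v\<^sub>2)).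
         u\<^sub>1 \<in> pverts G \<and> u\<^sub>2 \<in> pverts G \<and> v\<^sub>1 \<in> pverts H \<and> v\<^sub>2 \<in> pverts H \<and>
         (v\<^sub>1 = v\<^sub>2 \<and> (u\<^sub>1, u\<^sub>2) \<in> parcs G \<or> u\<^sub>1 = u\<^sub>2 \<and> (v\<^sub>1, v\<^sub>2) \<in> parcs H)} \<rparr>"

lemma pair_graph_path_graph: "pair_graph (path_graph n)"
proof -
  have "finite {(i, j). i < n \<and> j < n \<and> (j = Suc i \<or> i = Suc j)}"
    by (rule finite_subset[of _ "{..<n} \<times> {..<n}"]) auto
  then show ?thesis
    by unfold_locales (auto simp: path_graph_def symmetric_def intro!: symI)
qed

lemma pair_graph_cartesian_product:
  assumes "pair_graph G" "pair_graph H"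
  shows "pair_graph (G \<box> H)"
proof -
  interpret G: pair_graph G by fact
  interpret H: pair_graph H by fact
  have sym: "sym (parcs G)" "sym (parcs H)"
    using G.pair_sym_arcs H.pair_sym_arcs by (simp_all add: symmetric_def)
  have "finite (parcs (G \<box> H))"
    by (rule finite_subset[of _ "(pverts G \<times> pverts H) \<times> (pverts G \<times> pverts H)"])
      (auto simp: cartesian_product_def)
  then show ?thesis
    using sym
    by unfold_locales
      (auto simp: cartesian_product_def symmetric_def intro!: symI
        dest: symD G.no_loops' H.no_loops')
qed

end

theory Submission
  imports Defs
begin

text \<open>
  A connected cograph has domination number at most 2: if the edge \<open>uv\<close> maximises
  \<open>|N[u] \<union> N[v]|\<close> and misses a vertex \<open>w\<close>, then a neighbour \<open>x\<close> of \<open>w\<close> inside that union must be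
  adjacent to both \<open>u\<close> and \<open>v\<close>, and the absence of induced paths makes \<open>ux\<close> a strictly better edge.

  If \<open>\<gamma> G = 1\<close>, project a dominating set of the product to \<open>H\<close>. If \<open>\<gamma> G = 2\<close>, let \<open>A\<close> be a maximal
  clique of \<open>G\<close> and \<open>B\<close> its complement; every vertex has a non-neighbour on the other side. For a
  dominating set \<open>D\<close> of the product let \<open>P\<close> be the projection to \<open>H\<close> of the part of \<open>D\<close> over \<open>A\<close> and
  \<open>L\<close> the set of vertices of \<open>H\<close> not dominated by \<open>P\<close>, so that \<open>\<gamma> H \<le> |P| + |L|\<close>. Over \<open>h \<in> L\<close> the
  set \<open>A\<close> can only be dominated from \<open>B\<close>, which takes at least two vertices; so \<open>|L|\<close> is paid for by
  the multiplicities of the projection over \<open>B\<close>. Adding the inequality with \<open>A\<close> and \<open>B\<close> exchanged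
  gives \<open>2 * \<gamma> H \<le> |D|\<close>.
\<close>

section \<open>Basic facts on graphs and the domination number\<close>

lemma pair_graph_arc_sym:
  assumes "pair_graph G" "(u, v) \<in> parcs G"
  shows "(v, u) \<in> parcs G"
proof -
  interpret pair_graph G by fact
  show ?thesis using pair_sym_arcs assms(2) by (auto simp: symmetric_def dest: symD)
qed

lemma pair_graph_arcD:
  assumes "pair_graph G" "(u, v) \<in> parcs G"
  shows "u \<in> pverts G" "v \<in> pverts G" "u \<noteq> v"
proof -
  interpret pair_graph G by fact
  show "u \<in> pverts G" "v \<in> pverts G" "u \<noteq> v"
    using assms(2) pair_no_loops[of "(u, v)"] by (auto dest: wellformed')
qed

lemma pair_graph_finite_verts: "pair_graph G \<Longrightarrow> finite (pverts G)"
  by (simp add: pair_graph_def pair_digraph_def pair_fin_digraph_def pair_fin_digraph_axioms_def)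

lemma domination_number_le: "dominating_set G S \<Longrightarrow> \<gamma> G \<le> card S"
  unfolding domination_number_def by (rule Least_le) auto

lemma domination_number_attained: "\<exists>S. dominating_set G S \<and> card S = \<gamma> G"
  unfolding domination_number_def
  by (rule LeastI[of _ "card (pverts G)"]) (auto simp: dominating_set_def)

section \<open>Connected cographs and their domination number\<close>

text \<open>Symmetric arcs make connectedness strong, so a set that no arc leaves would contain
  everything reachable from \<open>v\<close>, hence \<open>z\<close>.\<close>

lemma connected_crossing_arc:
  assumes G: "pair_graph G" "connected G"
    and S: "v \<in> S" "v \<in> pverts G" "z \<in> pverts G" "z \<notin> S"
  shows "\<exists>x \<in> S. \<exists>w. w \<notin> S \<and> (x, w) \<in> parcs G"
proof (rule ccontr)
  assume closed: "\<not> ?thesis"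
  interpret pair_graph G by fact
  have "strongly_connected G"
    using symmetric_connected_imp_strongly_connected G(2) pair_sym_arcs by blast
  then have "v \<rightarrow>\<^sup>*\<^bsub>with_proj G\<^esub> z"
    using S by (auto simp: strongly_connected_def)
  then have "z \<in> S"
    by (induction rule: reachable_induct) (use S(1) closed in auto)
  with S show False by simp
qed

text \<open>Replaces the isomorphism in the definition of \<open>cograph\<close> by a test on six
  pairs.\<close>

lemma cograph_no_induced_P4:
  assumes G: "pair_graph G" "cograph G"
    and arcs: "(a, b) \<in> parcs G" "(b, c) \<in> parcs G" "(c, d) \<in> parcs G"
    and nonarcs: "(a, c) \<notin> parcs G" "(b, d) \<notin> parcs G" "(a, d) \<notin> parcs G"
  shows False
proof -
  interpret pair_graph G by fact
  note sym = pair_graph_arc_sym[OF G(1)] and arcD = pair_graph_arcD[OF G(1)]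
  \<comment> \<open>Each coincidence would give a loop or turn one of the nonarcs into an
    arc.\<close>
  have dist: "a \<noteq> b" "a \<noteq> c" "a \<noteq> d" "b \<noteq> c" "b \<noteq> d" "c \<noteq> d"
    using arcs nonarcs arcD sym by blast+
  define S where "S = {a, b, c, d}"
  define f where "f x = (if x = a then 0 else if x = b then 1 else if x = c then 2 else 3 :: nat)" for x
  define h where "h = \<lparr> iso_verts = f, iso_arcs = map_prod f f, iso_head = snd, iso_tail = fst \<rparr>"
  let ?K = "with_proj G \<restriction> S"
  have "S \<subseteq> pverts G"
    using arcs arcD by (auto simp: S_def)
  then have ind: "induced_subgraph ?K G"
    by (intro induced_induce) auto
  have noloop: "(x, x) \<notin> parcs G" for x
    using arcD by blast
  have "(b, a) \<in> parcs G" "(c, b) \<in> parcs G" "(d, c) \<in> parcs G"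
    "(c, a) \<notin> parcs G" "(d, b) \<notin> parcs G" "(d, a) \<notin> parcs G"
    using arcs nonarcs sym by blast+
  moreover have "arcs ?K = parcs G \<inter> S \<times> S"
    by auto
  moreover have "S \<times> S = {(a, a), (a, b), (a, c), (a, d), (b, a), (b, b), (b, c), (b, d),
      (c, a), (c, b), (c, c), (c, d), (d, a), (d, b), (d, c), (d, d)}"
    unfolding S_def by blast
  ultimately have KA: "arcs ?K = {(a, b), (b, a), (b, c), (c, b), (c, d), (d, c)}"
    using arcs nonarcs noloop by (simp add: Int_insert_right)
  have fv: "f a = 0" "f b = 1" "f c = 2" "f d = 3"
    using dist by (auto simp: f_def)
  have injf: "inj_on f S"
    by (auto simp: S_def inj_on_def fv)
  have injm: "inj_on (map_prod f f) (arcs ?K)"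
    using map_prod_inj_on[OF injf injf] by (rule inj_on_subset) auto
  have "wf_digraph ?K"
    using ind by (auto simp: induced_subgraph_def subgraph_def)
  then have "pre_digraph.digraph_isomorphism ?K h"
    unfolding pre_digraph.digraph_isomorphism_def using injf injm
    by (simp add: h_def)
  moreover have "with_proj (path_graph 4) = app_iso h ?K"
  proof -
    have "{(i, j). i < 4 \<and> j < (4::nat) \<and> (j = Suc i \<or> i = Suc j)} =
        {(0, 1), (1, 0), (1, 2), (2, 1), (2, 3), (3, 2)}"
      by auto
    moreover have "map_prod f f ` arcs ?K = {(0, 1), (1, 0), (1, 2), (2, 1), (2, 3), (3, 2)}"
      unfolding KA by (simp add: fv)
    moreover have "f ` S = {..<4}"
      by (auto simp: S_def fv)
    ultimately show ?thesis
      by (simp add: app_iso_def with_proj_def path_graph_def h_def)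
  qed
  ultimately have "digraph_iso ?K (path_graph 4)"
    unfolding digraph_iso_def by blast
  with ind G(2) show False
    unfolding cograph_def by blast
qed

lemma connected_cograph_domination_number_le_2:
  assumes G: "pair_graph G" "connected G" "cograph G"
  shows "\<gamma> G \<le> 2"
proof -
  note sym = pair_graph_arc_sym[OF G(1)] and arcD = pair_graph_arcD[OF G(1)]
    and P4 = cograph_no_induced_P4[OF G(1,3)]
    and crossing = connected_crossing_arc[OF G(1,2)]
  obtain p where p: "p \<in> pverts G"
    using G(2) unfolding connected_def strongly_connected_def by auto
  show ?thesis
  proof (cases "parcs G = {}")
    case True
    then have "dominating_set G {p}"
      using crossing[of p "{p}"] p unfolding dominating_set_def by auto
    then show ?thesis
      using domination_number_le by fastforce
  next
    case False
    define N where "N u = insert u {x. (u, x) \<in> parcs G}" for u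
    define m where "m = (\<lambda>(u, v). card (N u \<union> N v))"
    have finN: "finite (N u)" for u
      unfolding N_def
      by (rule finite.insertI, rule finite_subset[OF _ pair_graph_finite_verts[OF G(1)]])
        (use arcD in blast)
    have "finite (parcs G)"
      by (rule finite_subset[of _ "pverts G \<times> pverts G"])
        (auto dest: arcD(1,2) simp: pair_graph_finite_verts[OF G(1)])
    then have "Max (m ` parcs G) \<in> m ` parcs G" "\<And>e'. e' \<in> parcs G \<Longrightarrow> m e' \<le> Max (m ` parcs G)"
      using False by simp_all
    then obtain e where e: "e \<in> parcs G" "\<And>e'. e' \<in> parcs G \<Longrightarrow> m e' \<le> m e"
      by (metis imageE)
    obtain u v where uv: "(u, v) \<in> parcs G" and e_eq: "e = (u, v)"
      using e(1) by (cases e) auto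
    have improve: "N s \<union> N t \<subseteq> N s \<union> N x \<and> (s, x) \<in> parcs G"
      if st: "(s, t) \<in> parcs G" and x: "x \<in> N s" "(x, w) \<in> parcs G" "w \<notin> N s \<union> N t"
      for s t x w
    proof -
      \<comment> \<open>Were \<open>q\<close> adjacent to only one of \<open>s\<close> and
        \<open>t\<close>, then \<open>s\<close>, \<open>t\<close>, \<open>q\<close>,
        \<open>w\<close> would span an induced path ending in \<open>q\<close>,
        \<open>w\<close>.\<close>
      have outside: "(s, q) \<in> parcs G \<and> (t, q) \<in> parcs G"
        if "q \<in> N s \<union> N t" "(q, w) \<in> parcs G" for q
      proof -
        have nw: "(s, w) \<notin> parcs G" "(t, w) \<notin> parcs G"
          using x(3) by (auto simp: N_def)
        have "(s, q) \<in> parcs G \<or> (t, q) \<in> parcs G"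
          using that nw by (auto simp: N_def)
        moreover have "(t, q) \<in> parcs G" if "(s, q) \<in> parcs G"
          using P4[of t s q w] st sym \<open>(q, w) \<in> parcs G\<close> nw that by blast
        moreover have "(s, q) \<in> parcs G" if "(t, q) \<in> parcs G"
          using P4[of s t q w] st sym \<open>(q, w) \<in> parcs G\<close> nw that by blast
        ultimately show ?thesis by blast
      qed
      have x_adj: "(s, x) \<in> parcs G" "(t, x) \<in> parcs G"
        using outside x by blast+
      \<comment> \<open>A lost vertex \<open>y\<close> would give the induced path \<open>y\<close>,
        \<open>t\<close>, \<open>x\<close>, \<open>w\<close>; \<open>outside\<close> excludes an arc
        from \<open>y\<close> to \<open>w\<close>, since \<open>y\<close> is not adjacent to
        \<open>s\<close>.\<close>
      have "y \<in> N s \<union> N x" if y: "y \<in> N t" for y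
      proof (rule ccontr)
        assume no: "y \<notin> N s \<union> N x"
        then have "(t, y) \<in> parcs G"
          using y st by (auto simp: N_def)
        moreover have "(y, w) \<notin> parcs G"
          using outside[of y] y no by (auto simp: N_def)
        ultimately show False
          using P4[of y t x w] sym no x x_adj unfolding N_def by blast
      qed
      with x_adj show ?thesis by blast
    qed
    have maximal: "(s, x) \<in> parcs G \<Longrightarrow> N u \<union> N v \<subseteq> N s \<union> N x \<Longrightarrow> N s \<union> N x \<subseteq> N u \<union> N v" for s x
      using e(2)[of "(s, x)"] card_seteq[of "N s \<union> N x" "N u \<union> N v"] finN
      unfolding e_eq m_def by auto
    have "pverts G \<subseteq> N u \<union> N v"
    proof (rule ccontr)
      assume "\<not> ?thesis"
      then obtain z where "z \<in> pverts G" "z \<notin> N u \<union> N v" by blast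
      then obtain x w where xw: "x \<in> N u \<union> N v" "w \<notin> N u \<union> N v" "(x, w) \<in> parcs G"
        using crossing[of u "N u \<union> N v" z] arcD[OF uv] by (auto simp: N_def)
      then have w: "w \<in> N x" by (simp add: N_def)
      \<comment> \<open>The end of \<open>uv\<close> whose closed neighbourhood contains
        \<open>x\<close> is kept; the new edge also covers \<open>w\<close>, against
        maximality.\<close>
      from xw(1) show False
      proof
        assume "x \<in> N u"
        then have "N u \<union> N v \<subseteq> N u \<union> N x" "(u, x) \<in> parcs G"
          using improve[of u v x w] uv xw by auto
        then show False using maximal w xw(2) by blast
      next
        assume "x \<in> N v"
        then have "N v \<union> N u \<subseteq> N v \<union> N x" "(v, x) \<in> parcs G"
          using improve[of v u x w] sym[OF uv] xw by auto
        then show False using maximal[of v x] w xw(2) by blast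
      qed
    qed
    then have "dominating_set G {u, v}"
      using arcD[OF uv] by (auto simp: dominating_set_def N_def)
    then show ?thesis
      using domination_number_le[of G "{u, v}"] arcD(3)[OF uv] by simp
  qed
qed

section \<open>Domination in the Cartesian product\<close>

lemma domination_number_le_card_plus_undominated:
  assumes "P \<subseteq> pverts H"
  shows "\<gamma> H \<le> card P + card {h \<in> pverts H. h \<notin> P \<and> (\<forall>u \<in> P. (u, h) \<notin> parcs H)}"
proof -
  let ?L = "{h \<in> pverts H. h \<notin> P \<and> (\<forall>u \<in> P. (u, h) \<notin> parcs H)}"
  have "dominating_set H (P \<union> ?L)"
    using assms by (auto simp: dominating_set_def)
  then have "\<gamma> H \<le> card (P \<union> ?L)"
    by (rule domination_number_le)
  also have "\<dots> \<le> card P + card ?L"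
    by (rule card_Un_le)
  finally show ?thesis .
qed

lemma dominating_set_productE:
  assumes "dominating_set (G \<box> H) D" "g \<in> pverts G" "h \<in> pverts H"
  obtains "(g, h) \<in> D"
  | g' where "(g', h) \<in> D" "(g', g) \<in> parcs G"
  | h' where "(g, h') \<in> D" "(h', h) \<in> parcs H"
  using assms unfolding dominating_set_def cartesian_product_def by fastforce

text \<open>A dominator of \<open>(g, h)\<close> in the product projects to \<open>h\<close> or to a
  neighbour of \<open>h\<close>, so a single fixed \<open>g\<close> shows that the projection
  dominates \<open>H\<close>.\<close>

lemma domination_number_le_product:
  assumes "pverts G \<noteq> {}" and fin: "finite (pverts G)" "finite (pverts H)"
  shows "\<gamma> H \<le> \<gamma> (G \<box> H)"
proof -
  obtain g where g: "g \<in> pverts G" using assms by blast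
  obtain D where D: "dominating_set (G \<box> H) D" "card D = \<gamma> (G \<box> H)"
    using domination_number_attained by blast
  have sub: "D \<subseteq> pverts G \<times> pverts H"
    using D(1) by (auto simp: dominating_set_def cartesian_product_def)
  have "dominating_set H (snd ` D)"
    unfolding dominating_set_def
  proof (intro conjI ballI)
    show "snd ` D \<subseteq> pverts H" using sub by auto
    fix h assume "h \<in> pverts H"
    from D(1) g this show "h \<in> snd ` D \<or> (\<exists>u \<in> snd ` D. (u, h) \<in> parcs H)"
      by (cases rule: dominating_set_productE) force+
  qed
  then have "\<gamma> H \<le> card (snd ` D)" by (rule domination_number_le)
  also have "\<dots> \<le> card D"
    using fin finite_subset[OF sub] by (intro card_image_le) auto
  finally show ?thesis using D(2) by simp
qed

text \<open>For a maximal clique \<open>A\<close>, a non-neighbour of a member must lie outside, and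
  a vertex outside adjacent to all of \<open>A\<close> would enlarge the clique.\<close>

lemma clique_partition_nonadjacent:
  assumes "finite V" and sym: "\<And>u v. (u, v) \<in> E \<Longrightarrow> (v, u) \<in> E"
    and nodom: "\<And>v. v \<in> V \<Longrightarrow> \<exists>u \<in> V. u \<noteq> v \<and> (v, u) \<notin> E"
  shows "\<exists>A B. A \<union> B = V \<and> A \<inter> B = {} \<and>
    (\<forall>a \<in> A. \<exists>b \<in> B. (a, b) \<notin> E) \<and> (\<forall>b \<in> B. \<exists>a \<in> A. (b, a) \<notin> E)"
proof -
  define C where "C = {K. K \<subseteq> V \<and> (\<forall>x \<in> K. \<forall>y \<in> K. x \<noteq> y \<longrightarrow> (x, y) \<in> E)}"
  have "finite C" "{} \<in> C" using assms(1) by (auto simp: C_def)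
  then obtain A where A: "A \<in> C" and max: "\<And>K. K \<in> C \<Longrightarrow> A \<subseteq> K \<Longrightarrow> A = K"
    using finite_has_maximal[of C] by blast
  have "\<exists>b \<in> V - A. (a, b) \<notin> E" if "a \<in> A" for a
  proof -
    have "a \<in> V" using A that by (auto simp: C_def)
    then obtain b where b: "b \<in> V" "b \<noteq> a" "(a, b) \<notin> E" using nodom by blast
    then have "b \<notin> A" using A that by (auto simp: C_def)
    with b show ?thesis by blast
  qed
  moreover have "\<exists>a \<in> A. (b, a) \<notin> E" if "b \<in> V - A" for b
  proof (rule ccontr)
    assume "\<not> ?thesis"
    then have "insert b A \<in> C"
      using A that sym by (auto simp: C_def)
    then show False using max[of "insert b A"] that by blast
  qed
  ultimately show ?thesis
    using A unfolding C_def by (intro exI[of _ A] exI[of _ "V - A"]) auto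
qed

text \<open>The two projection sizes stand on opposite sides, so they cancel when the inequality is
  added to the one with \<open>A\<close> and \<open>B\<close> exchanged.\<close>

lemma domination_number_le_side_count:
  assumes D: "dominating_set (G \<box> H) D" "finite D"
    and AB: "A \<union> B = pverts G" "A \<noteq> {}"
    and nonadj: "\<And>b. b \<in> B \<Longrightarrow> \<exists>a \<in> A. (b, a) \<notin> parcs G"
  shows "\<gamma> H + card (snd ` {x \<in> D. fst x \<in> B}) \<le>
    card (snd ` {x \<in> D. fst x \<in> A}) + card {x \<in> D. fst x \<in> B}"
proof -
  define P where "P = snd ` {x \<in> D. fst x \<in> A}"
  define L where "L = {h \<in> pverts H. h \<notin> P \<and> (\<forall>u \<in> P. (u, h) \<notin> parcs H)}"
  define DB where "DB = {x \<in> D. fst x \<in> B}"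
  define F where "F h = {x \<in> DB. snd x = h}" for h
  have sub: "D \<subseteq> pverts G \<times> pverts H"
    using D(1) by (auto simp: dominating_set_def cartesian_product_def)
  have finDB: "finite DB" using D(2) by (simp add: DB_def)
  then have finF: "finite (F h)" for h by (simp add: F_def)
  \<comment> \<open>Any other dominator of \<open>(a, h)\<close> would lie over \<open>A\<close> and
    put \<open>h\<close>, or a neighbour of \<open>h\<close>, into \<open>P\<close>.\<close>
  have from_B: "\<exists>b \<in> B. (b, h) \<in> D \<and> (b, a) \<in> parcs G" if "a \<in> A" "h \<in> L" for a h
  proof -
    have inP: "(a', h') \<in> D \<Longrightarrow> a' \<in> A \<Longrightarrow> h' \<in> P" for a' h'
      by (force simp: P_def)
    have "a \<in> pverts G" "h \<in> pverts H" using that AB by (auto simp: L_def)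
    with D(1) show ?thesis
    proof (cases rule: dominating_set_productE)
      case (2 g')
      then show ?thesis using inP[of g' h] sub AB that by (auto simp: L_def)
    qed (use inP that in \<open>auto simp: L_def\<close>)
  qed
  \<comment> \<open>The first dominator \<open>b\<close> misses some \<open>a\<close> in
    \<open>A\<close>, and this \<open>a\<close> forces a second one.\<close>
  have two: "2 \<le> card (F h)" if h: "h \<in> L" for h
  proof -
    obtain b where b: "b \<in> B" "(b, h) \<in> D"
      using from_B h AB(2) by blast
    obtain a where "a \<in> A" "(b, a) \<notin> parcs G" using nonadj b by blast
    with from_B h obtain b' where b': "b' \<in> B" "(b', h) \<in> D" "b' \<noteq> b" by blast
    have "card {(b, h), (b', h)} \<le> card (F h)"
      using b b' finF by (intro card_mono) (auto simp: F_def DB_def)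
    then show ?thesis using b'(3) by simp
  qed
  have one: "1 \<le> card (F h)" if "h \<in> snd ` DB" for h
    using that finF[of h] by (auto simp: F_def Suc_le_eq card_gt_0_iff)
  have L_sub: "L \<subseteq> snd ` DB"
  proof
    fix h assume "h \<in> L"
    then have "F h \<noteq> {}" using two by fastforce
    then show "h \<in> snd ` DB" by (force simp: F_def)
  qed
  \<comment> \<open>Each fibre of the projection has at least one element, and at least two over
    \<open>L\<close>; summing the fibres gives \<open>card DB\<close>.\<close>
  have "card (snd ` DB) + card L = (\<Sum>h \<in> snd ` DB. 1 + (if h \<in> L then 1 else 0))"
    unfolding sum.distrib using L_sub finDB by (simp add: sum.If_cases Int_absorb1)
  also have "\<dots> \<le> (\<Sum>h \<in> snd ` DB. card (F h))"
    using one two by (intro sum_mono) (auto simp: numeral_2_eq_2)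
  also have "\<dots> = card DB"
    using sum.image_gen[OF finDB, of "\<lambda>_. 1::nat" snd] by (simp add: F_def)
  finally have "card (snd ` DB) + card L \<le> card DB" .
  moreover have "\<gamma> H \<le> card P + card L"
    unfolding L_def by (rule domination_number_le_card_plus_undominated) (use sub in \<open>auto simp: P_def\<close>)
  ultimately show ?thesis by (simp add: P_def DB_def)
qed

lemma two_times_domination_number_le_product:
  assumes G: "pair_graph G" and H: "pair_graph H" and two: "2 \<le> \<gamma> G"
  shows "2 * \<gamma> H \<le> \<gamma> (G \<box> H)"
proof -
  note sym = pair_graph_arc_sym[OF G]
  obtain D where D: "dominating_set (G \<box> H) D" "card D = \<gamma> (G \<box> H)"
    using domination_number_attained by blast
  have sub: "D \<subseteq> pverts G \<times> pverts H"
    using D(1) by (auto simp: dominating_set_def cartesian_product_def)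
  then have finD: "finite D"
    using G H by (meson finite_SigmaI finite_subset pair_graph_finite_verts)
  have "\<exists>u \<in> pverts G. u \<noteq> v \<and> (v, u) \<notin> parcs G" if "v \<in> pverts G" for v
  proof (rule ccontr)
    assume "\<not> ?thesis"
    then have "dominating_set G {v}" using that by (auto simp: dominating_set_def)
    then show False using domination_number_le two by fastforce
  qed
  then obtain A B where AB: "A \<union> B = pverts G" "A \<inter> B = {}"
    and nonadj: "\<And>a. a \<in> A \<Longrightarrow> \<exists>b \<in> B. (a, b) \<notin> parcs G"
      "\<And>b. b \<in> B \<Longrightarrow> \<exists>a \<in> A. (b, a) \<notin> parcs G"
    using clique_partition_nonadjacent[of "pverts G" "parcs G"] pair_graph_finite_verts[OF G] sym
    by metis
  have "pverts G \<noteq> {}"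
    using domination_number_le[of G "{}"] two by (auto simp: dominating_set_def)
  then have "A \<noteq> {}" "B \<noteq> {}" using AB nonadj by blast+
  then have "\<gamma> H + card (snd ` {x \<in> D. fst x \<in> B}) \<le>
      card (snd ` {x \<in> D. fst x \<in> A}) + card {x \<in> D. fst x \<in> B}"
    "\<gamma> H + card (snd ` {x \<in> D. fst x \<in> A}) \<le>
      card (snd ` {x \<in> D. fst x \<in> B}) + card {x \<in> D. fst x \<in> A}"
    using AB nonadj D(1) finD
    by (intro domination_number_le_side_count; auto)+
  moreover have "card {x \<in> D. fst x \<in> A} + card {x \<in> D. fst x \<in> B} = card D"
    using finD sub AB by (subst card_Un_disjoint[symmetric]) (auto intro!: arg_cong[where f = card])
  ultimately show ?thesis using D(2) by linarith
qed

theorem theorem2p1: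
  fixes G :: "'a pair_pre_digraph" and H :: "'b pair_pre_digraph"
  assumes "pair_graph G" and "connected G"
    and "pair_graph H" and "connected H"
    and "cograph G"
  shows "\<gamma> (G \<box> H) \<ge> \<gamma> G * \<gamma> H"
proof -
  have "pverts G \<noteq> {}"
    using assms(2) unfolding connected_def strongly_connected_def by auto
  then have one: "\<gamma> H \<le> \<gamma> (G \<box> H)"
    using assms by (intro domination_number_le_product pair_graph_finite_verts)
  have "\<gamma> G \<le> 2"
    using assms by (intro connected_cograph_domination_number_le_2)
  then consider "\<gamma> G = 0" | "\<gamma> G = 1" | "\<gamma> G = 2" by linarith
  then show ?thesis
  proof cases
    case 3
    then show ?thesis
      using two_times_domination_number_le_product[OF assms(1,3)] by simp
  qed (use one in simp_all)
qed

end
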